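(* Let $\mathbb{F}_q$ be the finite field with $q$ elements and let $k=(q^2-q)/2$. Let $c$ be the number of purely core subsets of $M_2(\mathbb{F}_q)$, and let $c'$ be the number of core subsets of $M_2(\mathbb{F}_q)$ that are not purely core. Then $$c' < \Big(\frac{1}{2^k}\Big)c.$$
   Context: $M_2(\mathbb{F}_q)$ is the ring of $2\times 2$ matrices over $\mathbb{F}_q$. In the polynomial ring $M_2(\mathbb{F}_q)[x]$ the variable $x$ commutes with all coefficients, and polynomials are evaluated from the right: for $f=\sum_i \alpha_i x^i$ with $\alpha_i\in M_2(\mathbb{F}_q)$ and $A\in M_2(\mathbb{F}_q)$, $f(A)=\sum_i \alpha_i A^i$. For $S\subseteq M_2(\mathbb{F}_q)$, the null ideal of $S$ is $N(S)=\{f\in M_2(\mathbb{F}_q)[x] \mid f(A)=0 \text{ for all } A\in S\}$. The set $S$ is called core if $N(S)$ is a two-sided ideal of $M_2(\mathbb{F}_q)[x]$, and noncore otherwise. The empty set is core. For a monic polynomial $m\in\mathbb{F}_q[x]$, the minimal polynomial class $\mathcal{C}(m)$ is the set of matrices in $M_2(\mathbb{F}_q)$ whose minimal polynomial is $m$. A set $S\subseteq M_2(\mathbb{F}_q)$ is called purely core if $S\cap\mathcal{C}$ is core for all minimal polynomial classes $\mathcal{C}$. (Every purely core set is core.) *)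

theory Defs
  imports
    "HOL-Algebra.UnivPoly"
    "HOL-Computational_Algebra.Polynomial"
    "Jordan_Normal_Form.Matrix"
begin

abbreviation M2 :: "'a::field mat ring" where
  "M2 \<equiv> ring_mat TYPE('a) 2 ()"

text \<open>
  Since \<^const>\<open>ring_mat\<close> is noncommutative, \<open>UP M2\<close> is the ring of polynomials with matrix
  coefficients in a central variable, and \<^const>\<open>UnivPoly.eval\<close> puts the coefficients to the
  left of the powers of the argument: it maps \<open>f\<close> to the sum of \<open>\<alpha>\<^sub>i A\<^sup>i\<close>. This map is not
  multiplicative in general.
\<close>

definition null_ideal :: "'a::field mat set \<Rightarrow> (nat \<Rightarrow> 'a mat) set" where
  "null_ideal S = {f \<in> carrier (UP M2). \<forall>A\<in>S. UnivPoly.eval M2 M2 id A f = \<zero>\<^bsub>M2\<^esub>}"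

text \<open>\<^const>\<open>ideal\<close> means a two-sided ideal.\<close>

definition core :: "'a::field mat set \<Rightarrow> bool" where
  "core S \<longleftrightarrow> ideal (null_ideal S) (UP M2)"

definition poly_at_mat :: "'a::field poly \<Rightarrow> 'a mat \<Rightarrow> 'a mat" where
  "poly_at_mat p A =
    (\<Oplus>\<^bsub>M2\<^esub>i \<in> {..degree p}. Polynomial.coeff p i \<cdot>\<^sub>m (A [^]\<^bsub>M2\<^esub> i))"

definition is_min_poly :: "'a::field poly \<Rightarrow> 'a mat \<Rightarrow> bool" where
  "is_min_poly m A \<longleftrightarrow>
    lead_coeff m = 1 \<and> poly_at_mat m A = \<zero>\<^bsub>M2\<^esub> \<and>
    (\<forall>p. p \<noteq> 0 \<and> poly_at_mat p A = \<zero>\<^bsub>M2\<^esub> \<longrightarrow> degree m \<le> degree p)"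

definition min_poly_class :: "'a::field poly \<Rightarrow> 'a mat set" where
  "min_poly_class m = {A \<in> carrier M2. is_min_poly m A}"

text \<open>
  The quantifier includes monic \<open>m\<close> that are not the minimal polynomial of any matrix; their
  class is empty, and the empty set is core.
\<close>

definition purely_core :: "'a::field mat set \<Rightarrow> bool" where
  "purely_core S \<longleftrightarrow> (\<forall>m. lead_coeff m = 1 \<longrightarrow> core (S \<inter> min_poly_class m))"

end

theory Submission
  imports Defs
begin

text \<open>
  A set \<open>S\<close> is core iff every \<open>f = \<Sum> \<alpha>\<^sub>i x\<^sup>i\<close> in its null ideal satisfies \<open>\<Sum> \<alpha>\<^sub>i B A\<^sup>i = 0\<close> for all
  \<open>A \<in> S\<close> and all matrices \<open>B\<close>. If \<open>T\<close> is a noncore set of nonscalar matrices with trace \<open>s\<close> and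
  determinant \<open>d\<close>, then some \<open>\<alpha> \<noteq> 0\<close> satisfies \<open>\<alpha> A = \<alpha> A\<^sub>0\<close> for all \<open>A, A\<^sub>0 \<in> T\<close>, so that \<open>\<alpha> x - \<alpha> A\<^sub>0\<close>
  kills \<open>T\<close>. Multiplying this linear polynomial by central quadratics that kill the other
  matrices and are invertible on \<open>T\<close> shows that the part of a core set in the class of an
  irreducible polynomial or of \<open>(x - a)\<^sup>2\<close> is core. Hence a core set that is not purely core has a
  noncore part in the class of some \<open>(x - a)(x - b)\<close> with \<open>a \<noteq> b\<close>, and such a part is nonempty and
  consists of matrices with a common left eigenvector and a common eigenvalue in \<open>{a, b}\<close>. The class
  has \<open>q\<^sup>2 + q\<close> elements, but for each of the \<open>q + 1\<close> lines and each of the two eigenvalues only \<open>q\<close>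
  of them qualify. So among the subsets of the union \<open>X\<close> of these classes at most
  \<open>q(q - 1)(q + 1)(2\<^sup>q - 1) 2\<^bsup>|X| - q\<^sup>2 - q\<^esup>\<close> are not purely core, which is less than \<open>2\<^bsup>|X|\<^esup> / (2\<^sup>k + 1)\<close>.
\<close>

section \<open>Two-by-two matrices and right evaluation\<close>

text \<open>A separate type makes the 2x2 matrices an instance of \<open>ring_1\<close>, so that
  class-based sums, powers and \<open>algebra_simps\<close> apply and identities reduce to entries
  by case distinction.\<close>

datatype 'a m2 = Mtx 'a 'a 'a 'a

instantiation m2 :: (comm_ring_1) ring_1
begin

definition "0 = Mtx 0 0 0 0"
definition "1 = Mtx 1 0 0 1"
fun plus_m2 where "plus_m2 (Mtx a b c d) (Mtx a' b' c' d') = Mtx (a + a') (b + b') (c + c') (d + d')"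
fun minus_m2 where "minus_m2 (Mtx a b c d) (Mtx a' b' c' d') = Mtx (a - a') (b - b') (c - c') (d - d')"
fun uminus_m2 where "uminus_m2 (Mtx a b c d) = Mtx (- a) (- b) (- c) (- d)"
fun times_m2 where "times_m2 (Mtx a b c d) (Mtx a' b' c' d') =
  Mtx (a * a' + b * c') (a * b' + b * d') (c * a' + d * c') (c * b' + d * d')"

instance
proof
  fix x y z :: "'a m2"
  show "x * y * z = x * (y * z)" "x + y + z = x + (y + z)" "(x + y) * z = x * z + y * z"
    "x * (y + z) = x * y + x * z"
    by (cases x; cases y; cases z; simp add: algebra_simps)+
  show "x + y = y + x" "x - y = x + - y"
    by (cases x; cases y; simp add: algebra_simps)+
  show "0 + x = x" "- x + x = 0" "1 * x = x" "x * 1 = x" "0 \<noteq> (1 :: 'a m2)"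
    by (cases x; simp add: zero_m2_def one_m2_def)+
qed

end

instance m2 :: (finite) finite
proof
  have eq: "(UNIV :: 'a m2 set) = range (\<lambda>(a, b, c, d). Mtx a b c d)"
    by (auto simp: image_iff) (metis m2.exhaust)
  show "finite (UNIV :: 'a m2 set)"
    unfolding eq by (rule finite_imageI) simp
qed

section \<open>Transfer between \<open>m2\<close> and the matrices of the statement\<close>

fun toM :: "'a m2 \<Rightarrow> 'a mat" where
  "toM (Mtx a b c d) =
    mat 2 2 (\<lambda>(i, j). if i = 0 then (if j = 0 then a else b) else (if j = 0 then c else d))"

definition ofM :: "'a mat \<Rightarrow> 'a m2" where
  "ofM A = Mtx (A $$ (0, 0)) (A $$ (0, 1)) (A $$ (1, 0)) (A $$ (1, 1))"

lemma ofM_toM [simp]: "ofM (toM A) = A"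
  by (cases A) (simp add: ofM_def)

lemma toM_ofM [simp]: "A \<in> carrier_mat 2 2 \<Longrightarrow> toM (ofM A) = A"
  by (rule eq_matI) (auto simp: ofM_def less_2_cases_iff)

lemma toM_carrier [simp]: "toM A \<in> carrier_mat 2 2"
  by (cases A) simp

lemma toM_eq_iff [simp]: "toM A = toM B \<longleftrightarrow> A = B"
  by (metis ofM_toM)

lemma range_toM: "range toM = carrier_mat 2 2"
proof (intro subset_antisym subsetI)
  fix A :: "'a mat" assume "A \<in> carrier_mat 2 2"
  then show "A \<in> range toM"
    using toM_ofM[of A] by (metis rangeI)
qed auto

lemma toM_zero: "toM 0 = 0\<^sub>m 2 2"
  by (rule eq_matI) (auto simp: zero_m2_def)

lemma toM_one: "toM 1 = 1\<^sub>m 2"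
  by (rule eq_matI) (auto simp: one_m2_def less_2_cases_iff)

lemma toM_add: "toM (A + B) = toM A + toM B"
  by (cases A; cases B) (rule eq_matI, auto simp: less_2_cases_iff)

lemma toM_mult: "toM (A * B) = toM A * toM B"
  by (cases A; cases B) (rule eq_matI, auto simp: less_2_cases_iff scalar_prod_def numeral_2_eq_2)

interpretation M2: ring "M2 :: 'a::field mat ring"
  by (rule ring_mat)

interpretation UPM2: UP_ring "M2 :: 'a::field mat ring" "UP M2"
  by unfold_locales

lemma toM_power: "toM (A ^ n) = toM A [^]\<^bsub>M2\<^esub> n"
proof (induction n)
  case (Suc n)
  then show ?case
    by (simp add: power_Suc2 toM_mult del: power_Suc)
      (simp add: ring_mat_simps)
qed (simp add: toM_one ring_mat_simps)

lemma toM_sum: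
  assumes "finite I"
  shows "toM (\<Sum>i\<in>I. f i) = (\<Oplus>\<^bsub>M2\<^esub>i\<in>I. toM (f i))"
  using assms
proof (induction I)
  case (insert i I)
  then show ?case
    by (subst M2.finsum_insert) (auto simp: toM_add ring_mat_simps)
qed (simp add: toM_zero ring_mat_simps)

section \<open>Right evaluation of finitely supported coefficient sequences\<close>

definition finsupp :: "(nat \<Rightarrow> 'a::zero) \<Rightarrow> bool" where
  "finsupp g \<longleftrightarrow> finite {i. g i \<noteq> 0}"

definition evalr :: "(nat \<Rightarrow> 'a::ring_1) \<Rightarrow> 'a \<Rightarrow> 'a" where
  "evalr g A = (\<Sum>i | g i \<noteq> 0. g i * A ^ i)"

definition conv :: "(nat \<Rightarrow> 'a::ring_1) \<Rightarrow> (nat \<Rightarrow> 'a) \<Rightarrow> nat \<Rightarrow> 'a" where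
  "conv g h n = (\<Sum>i\<le>n. g i * h (n - i))"

lemma finsupp_bound: "finsupp g \<Longrightarrow> \<exists>n. \<forall>i>n. g i = 0"
  unfolding finsupp_def finite_nat_set_iff_bounded_le by (auto simp: not_le[symmetric])

lemma finsuppI: "(\<And>i. i > n \<Longrightarrow> g i = 0) \<Longrightarrow> finsupp g"
  unfolding finsupp_def finite_nat_set_iff_bounded_le by (metis (mono_tags) leI mem_Collect_eq)

lemma evalr_eq: "(\<And>i. i > n \<Longrightarrow> g i = 0) \<Longrightarrow> evalr g A = (\<Sum>i\<le>n. g i * A ^ i)"
  unfolding evalr_def
  by (rule sum.mono_neutral_left) (auto simp: not_le[symmetric])

lemma finsupp_compose: "finsupp g \<Longrightarrow> (\<And>i. g i = 0 \<Longrightarrow> h i = 0) \<Longrightarrow> finsupp h"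
  unfolding finsupp_def by (erule rev_finite_subset) auto

lemma finsupp_add:
  fixes g h :: "nat \<Rightarrow> 'a::ring_1"
  assumes "finsupp g" "finsupp h"
  shows "finsupp (\<lambda>i. g i + h i)"
  using finite_UnI[OF assms[unfolded finsupp_def]] unfolding finsupp_def
  by (rule rev_finite_subset) auto

lemma evalr_add:
  assumes "finsupp g" "finsupp h"
  shows "evalr (\<lambda>i. g i + h i) A = evalr g A + evalr h A"
proof -
  obtain m n where "\<forall>i>m. g i = 0" "\<forall>i>n. h i = 0"
    using assms finsupp_bound by metis
  then show ?thesis
    by (simp add: evalr_eq[of "max m n"] sum.distrib algebra_simps)
qed

text \<open>The value of a product is a double sum of \<open>g i * h j * A ^ (i + j)\<close>.
  Summing over \<open>i\<close> first reduces right multiplication by \<open>h\<close> to right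
  multiplication by its constant coefficients; summing over \<open>j\<close> first shows that a zero
  of \<open>h\<close> is a zero of the product.\<close>

lemma conv_finsupp_evalr:
  assumes "finsupp g" "finsupp h"
  shows "finsupp (conv g h)"
    and "evalr (conv g h) A = (\<Sum>j | h j \<noteq> 0. evalr (\<lambda>i. g i * h j) A * A ^ j)"
    and "evalr (conv g h) A = (\<Sum>i | g i \<noteq> 0. g i * evalr h A * A ^ i)"
proof -
  obtain m n where m: "\<And>i. i > m \<Longrightarrow> g i = 0" and n: "\<And>i. i > n \<Longrightarrow> h i = 0"
    using assms finsupp_bound by metis
  have m': "g i \<noteq> 0 \<Longrightarrow> i \<le> m" and n': "h i \<noteq> 0 \<Longrightarrow> i \<le> n" for i
    using m n not_le by blast+
  have *: "conv g h k = 0" if "k > m + n" for k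
    unfolding conv_def
  proof (rule sum.neutral, safe)
    fix i
    show "g i * h (k - i) = 0"
      using that m[of i] n[of "k - i"] by (cases "i > m") auto
  qed
  show "finsupp (conv g h)"
    using * by (rule finsuppI)
  \<comment> \<open>The exponent is written \<open>i + (k - i)\<close> so that the summand depends
    on the pair \<open>(i, k - i)\<close>, as the triangular reindexing requires.\<close>
  have "evalr (conv g h) A = (\<Sum>k\<le>m + n. \<Sum>i\<le>k. g i * h (k - i) * A ^ (i + (k - i)))"
    by (simp add: evalr_eq[of "m + n", OF *] conv_def sum_distrib_right)
  also have "\<dots> = (\<Sum>(i, j)\<in>{(i, j). i + j \<le> m + n}. g i * h j * A ^ (i + j))"
    by (rule sum.triangle_reindex_eq[symmetric])
  also have "\<dots> = (\<Sum>(i, j)\<in>{..m} \<times> {..n}. g i * h j * A ^ (i + j))"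
  proof (rule sum.mono_neutral_right)
    show "finite {(i, j). i + j \<le> m + n}"
      by (rule finite_subset[of _ "{..m + n} \<times> {..m + n}"]) auto
    have *: "g i * h j * A ^ (i + j) = 0" if "(i, j) \<notin> {..m} \<times> {..n}" for i j
    proof -
      have "i > m \<or> j > n"
        using that by auto
      then show ?thesis
        using m n by auto
    qed
    show "\<forall>ij\<in>{(i, j). i + j \<le> m + n} - {..m} \<times> {..n}. (\<lambda>(i, j). g i * h j * A ^ (i + j)) ij = 0"
      by (intro ballI, split prod.split) (use * in blast)
  qed auto
  also have "\<dots> = (\<Sum>i\<le>m. \<Sum>j\<le>n. g i * h j * A ^ (i + j))"
    by (rule sum.cartesian_product[symmetric])
  finally have eq: "evalr (conv g h) A = (\<Sum>i\<le>m. \<Sum>j\<le>n. g i * h j * A ^ (i + j))" .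
  have "(\<Sum>j | h j \<noteq> 0. evalr (\<lambda>i. g i * h j) A * A ^ j)
      = (\<Sum>j\<le>n. evalr (\<lambda>i. g i * h j) A * A ^ j)"
    by (rule sum.mono_neutral_left) (auto simp: evalr_def n')
  also have "\<dots> = (\<Sum>j\<le>n. \<Sum>i\<le>m. g i * h j * A ^ (i + j))"
    by (simp add: evalr_eq[of m] m sum_distrib_right power_add mult.assoc)
  finally show "evalr (conv g h) A = (\<Sum>j | h j \<noteq> 0. evalr (\<lambda>i. g i * h j) A * A ^ j)"
    unfolding eq by (subst sum.swap) simp
  have "(\<Sum>i | g i \<noteq> 0. g i * evalr h A * A ^ i) = (\<Sum>i\<le>m. g i * evalr h A * A ^ i)"
    by (rule sum.mono_neutral_left) (auto simp: m')
  also have "\<dots> = (\<Sum>i\<le>m. \<Sum>j\<le>n. g i * h j * A ^ (i + j))"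
    by (simp add: evalr_eq[of n] n sum_distrib_right sum_distrib_left mult.assoc add.commute
        flip: power_add)
  finally show "evalr (conv g h) A = (\<Sum>i | g i \<noteq> 0. g i * evalr h A * A ^ i)"
    unfolding eq by simp
qed

text \<open>Of two-sidedness only the absorption of constants \<open>B\<close> on the right is kept;
  \<open>core_toM\<close> shows that this is equivalent.\<close>

definition core_m2 :: "'a::ring_1 set \<Rightarrow> bool" where
  "core_m2 S \<longleftrightarrow> (\<forall>g. finsupp g \<and> (\<forall>A\<in>S. evalr g A = 0) \<longrightarrow>
     (\<forall>B. \<forall>A\<in>S. evalr (\<lambda>i. g i * B) A = 0))"

lemma carrier_UP_M2_iff:
  "f \<in> carrier (UP (M2 :: 'a::field mat ring)) \<longleftrightarrow> (\<exists>g. finsupp g \<and> f = (\<lambda>i. toM (g i)))"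
proof
  assume "f \<in> carrier (UP (M2 :: 'a mat ring))"
  then have f: "f \<in> up (M2 :: 'a mat ring)"
    by (simp add: UP_def)
  then obtain n where n: "bound (0\<^sub>m 2 2) n f"
    by (auto simp: up_def ring_mat_simps)
  have "\<And>i. f i \<in> carrier_mat 2 2"
    using mem_upD[OF f] by (simp add: ring_mat_simps)
  then have "f = (\<lambda>i. toM (ofM (f i)))"
    by simp
  moreover have "finsupp (\<lambda>i. ofM (f i))"
    by (rule finsuppI[of n]) (use n in \<open>simp add: bound.bound flip: toM_zero\<close>)
  ultimately show "\<exists>g. finsupp g \<and> f = (\<lambda>i. toM (g i))"
    by blast
next
  assume "\<exists>g. finsupp g \<and> f = (\<lambda>i. toM (g i))"
  then obtain g n where "f = (\<lambda>i. toM (g i))" "\<forall>i>n. g i = 0"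
    using finsupp_bound by blast
  then show "f \<in> carrier (UP (M2 :: 'a mat ring))"
    by (auto simp: UP_def ring_mat_simps toM_zero intro!: mem_upI exI[of _ n])
qed

lemma coeff_UP_M2:
  "f \<in> carrier (UP (M2 :: 'a::field mat ring)) \<Longrightarrow> up_ring.coeff (UP M2) f i = f i"
  by (simp add: UP_def)

lemma eval_UP_M2:
  fixes g :: "nat \<Rightarrow> 'a::field m2"
  assumes "finsupp g"
  shows "UnivPoly.eval M2 M2 id (toM A) (\<lambda>i. toM (g i)) = toM (evalr g A)"
proof -
  let ?f = "\<lambda>i. toM (g i)"
  have f: "?f \<in> carrier (UP M2)"
    using assms carrier_UP_M2_iff by blast
  have "g i = 0" if "i > deg M2 ?f" for i
    using UPM2.deg_aboveD[OF that f] f by (simp add: coeff_UP_M2 ring_mat_simps flip: toM_zero)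
  then have "toM (evalr g A) = (\<Oplus>\<^bsub>M2\<^esub>i\<in>{..deg M2 ?f}. toM (g i * A ^ i))"
    by (simp add: evalr_eq[of "deg M2 ?f"] toM_sum)
  also have "\<dots> = UnivPoly.eval M2 M2 id (toM A) ?f"
    using f by (simp add: UnivPoly.eval_def coeff_UP_M2 toM_mult toM_power)
      (simp add: ring_mat_simps)
  finally show ?thesis ..
qed

lemma null_ideal_iff:
  "f \<in> null_ideal (toM ` S) \<longleftrightarrow>
    (\<exists>g. finsupp g \<and> f = (\<lambda>i. toM (g i)) \<and> (\<forall>A\<in>S. evalr g A = 0))"
proof -
  have z: "\<zero>\<^bsub>M2\<^esub> = toM 0"
    by (simp add: ring_mat_simps toM_zero)
  show ?thesis
    unfolding null_ideal_def carrier_UP_M2_iff mem_Collect_eq z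
    by (auto simp: eval_UP_M2)
qed

lemma null_idealI:
  assumes "finsupp g" "\<And>A. A \<in> S \<Longrightarrow> evalr g A = 0"
  shows "(\<lambda>i. toM (g i)) \<in> null_ideal (toM ` S)"
  unfolding null_ideal_iff using assms by (intro exI[of _ g]) simp

lemma mult_UP_M2:
  fixes g h :: "nat \<Rightarrow> 'a::field m2"
  assumes "finsupp g" "finsupp h"
  shows "(\<lambda>i. toM (g i)) \<otimes>\<^bsub>UP M2\<^esub> (\<lambda>i. toM (h i)) = (\<lambda>i. toM (conv g h i))"
proof -
  have "(\<lambda>i. toM (g i)) \<in> carrier (UP M2)" "(\<lambda>i. toM (h i)) \<in> carrier (UP M2)"
    using assms carrier_UP_M2_iff by blast+
  then show ?thesis
    by (simp add: UP_def fun_eq_iff conv_def toM_sum toM_mult) (simp add: ring_mat_simps)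
qed

lemma add_UP_M2:
  fixes g h :: "nat \<Rightarrow> 'a::field m2"
  assumes "finsupp g" "finsupp h"
  shows "(\<lambda>i. toM (g i)) \<oplus>\<^bsub>UP M2\<^esub> (\<lambda>i. toM (h i)) = (\<lambda>i. toM (g i + h i))"
proof -
  have "(\<lambda>i. toM (g i)) \<in> carrier (UP M2)" "(\<lambda>i. toM (h i)) \<in> carrier (UP M2)"
    using assms carrier_UP_M2_iff by blast+
  then show ?thesis
    by (simp add: UP_def fun_eq_iff toM_add) (simp add: ring_mat_simps)
qed

lemma zero_UP_M2: "\<zero>\<^bsub>UP M2\<^esub> = (\<lambda>i. toM (0 :: 'a::field m2))"
  by (simp add: UP_def toM_zero ring_mat_simps)

text \<open>Right multiplication by \<open>x\<close> turns \<open>f(A)\<close> into \<open>f(A) A\<close>, so the null ideal, which is always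
  a left ideal, is two-sided as soon as it absorbs constants on the right.\<close>

lemma core_toM:
  fixes S :: "'a::field m2 set"
  shows "core (toM ` S) \<longleftrightarrow> core_m2 S"
proof
  assume "core (toM ` S)"
  then interpret ideal "null_ideal (toM ` S)" "UP M2"
    by (simp add: core_def)
  show "core_m2 S"
    unfolding core_m2_def
  proof (intro allI impI ballI)
    fix g :: "nat \<Rightarrow> 'a m2" and B A :: "'a m2"
    assume g: "finsupp g \<and> (\<forall>A\<in>S. evalr g A = 0)" and A: "A \<in> S"
    \<comment> \<open>The constant polynomial \<open>B\<close>: multiplying by it on the right
      replaces each coefficient \<open>g n\<close> by \<open>g n * B\<close>.\<close>
    define h where "h = (\<lambda>i::nat. if i = 0 then B else 0)"
    have h: "finsupp h"
      by (rule finsuppI[of 0]) (simp add: h_def)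
    have "(\<lambda>i. toM (g i)) \<in> null_ideal (toM ` S)"
      using g null_ideal_iff by blast
    moreover have "(\<lambda>i. toM (h i)) \<in> carrier (UP M2)"
      using h carrier_UP_M2_iff by blast
    ultimately have "(\<lambda>i. toM (conv g h i)) \<in> null_ideal (toM ` S)"
      using I_r_closed mult_UP_M2[OF conjunct1[OF g] h] by fastforce
    then obtain g' where "\<forall>i. conv g h i = g' i" "\<forall>A\<in>S. evalr g' A = 0"
      by (auto simp: null_ideal_iff fun_eq_iff)
    moreover from this have "conv g h = g'"
      by blast
    ultimately have "evalr (conv g h) A = 0"
      using A by blast
    moreover have "conv g h n = g n * B" for n
    proof -
      have "conv g h n = (\<Sum>i\<in>{n}. g i * h (n - i))"
        unfolding conv_def by (rule sum.mono_neutral_right) (auto simp: h_def)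
      then show ?thesis
        by (simp add: h_def)
    qed
    then have "conv g h = (\<lambda>n. g n * B)"
      by blast
    ultimately show "evalr (\<lambda>i. g i * B) A = 0"
      by simp
  qed
next
  assume S: "core_m2 S"
  show "core (toM ` S)"
    unfolding core_def
  proof (rule idealI)
    show "ring (UP (M2 :: 'a mat ring))"
      by (rule UPM2.UP_ring)
    fix f h
    assume f: "f \<in> null_ideal (toM ` S)" and h: "h \<in> carrier (UP (M2 :: 'a mat ring))"
    obtain f' where f': "finsupp f'" "f = (\<lambda>i. toM (f' i))" "\<forall>A\<in>S. evalr f' A = 0"
      using f null_ideal_iff by blast
    obtain h' where h': "finsupp h'" "h = (\<lambda>i. toM (h' i))"
      using h carrier_UP_M2_iff by blast
    have "evalr (conv h' f') A = 0" if "A \<in> S" for A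
      using f' h' that by (simp add: conv_finsupp_evalr(3))
    then show "h \<otimes>\<^bsub>UP M2\<^esub> f \<in> null_ideal (toM ` S)"
      unfolding f'(2) h'(2) mult_UP_M2[OF h'(1) f'(1)]
      by (rule null_idealI[OF conv_finsupp_evalr(1)[OF h'(1) f'(1)]])
    \<comment> \<open>Each term contains a value of \<open>f'\<close> multiplied on the right by one
      coefficient of \<open>h'\<close>, and this value is 0 by \<open>core_m2\<close>.\<close>
    have "evalr (conv f' h') A = 0" if "A \<in> S" for A
      using f' h' that S by (simp add: conv_finsupp_evalr(2) core_m2_def)
    then show "f \<otimes>\<^bsub>UP M2\<^esub> h \<in> null_ideal (toM ` S)"
      unfolding f'(2) h'(2) mult_UP_M2[OF f'(1) h'(1)]
      by (rule null_idealI[OF conv_finsupp_evalr(1)[OF f'(1) h'(1)]])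
  next
    have z: "(\<lambda>i. toM 0) \<in> null_ideal (toM ` S)"
      by (rule null_idealI) (auto simp: finsupp_def evalr_def)
    have n: "\<exists>h\<in>null_ideal (toM ` S). h \<oplus>\<^bsub>UP M2\<^esub> f = \<zero>\<^bsub>UP M2\<^esub>"
      if f: "f \<in> null_ideal (toM ` S)" for f
    proof -
      obtain f' where f': "finsupp f'" "f = (\<lambda>i. toM (f' i))" "\<forall>A\<in>S. evalr f' A = 0"
        using f null_ideal_iff by blast
      have f'': "finsupp (\<lambda>i. - f' i)"
        using f'(1) by (rule finsupp_compose) simp
      have "evalr (\<lambda>i. - f' i) A = - evalr f' A" for A
        by (simp add: evalr_def sum_negf)
      then have "(\<lambda>i. toM (- f' i)) \<in> null_ideal (toM ` S)"
        using f' f'' by (intro null_idealI) auto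
      moreover have "(\<lambda>i. toM (- f' i)) \<oplus>\<^bsub>UP M2\<^esub> f = \<zero>\<^bsub>UP M2\<^esub>"
        using f' f'' by (simp add: add_UP_M2 zero_UP_M2)
      ultimately show ?thesis
        by blast
    qed
    show "subgroup (null_ideal (toM ` S)) (add_monoid (UP (M2 :: 'a mat ring)))"
    proof (rule UPM2.P.add.subgroupI)
      show sub: "null_ideal (toM ` S) \<subseteq> carrier (UP M2)"
        by (auto simp: null_ideal_def)
      show "null_ideal (toM ` S) \<noteq> {}"
        using z by blast
      fix f assume f: "f \<in> null_ideal (toM ` S)"
      show "\<ominus>\<^bsub>UP M2\<^esub> f \<in> null_ideal (toM ` S)"
      proof -
        obtain f' where f': "f' \<in> null_ideal (toM ` S)" "f' \<oplus>\<^bsub>UP M2\<^esub> f = \<zero>\<^bsub>UP M2\<^esub>"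
          using n[OF f] by blast
        then have "\<ominus>\<^bsub>UP M2\<^esub> f = f'"
          using f sub by (intro UPM2.P.minus_equality) auto
        then show ?thesis
          using f' by simp
      qed
      fix h assume h: "h \<in> null_ideal (toM ` S)"
      obtain f' where f': "finsupp f'" "f = (\<lambda>i. toM (f' i))" "\<forall>A\<in>S. evalr f' A = 0"
        using f null_ideal_iff by blast
      obtain h' where h': "finsupp h'" "h = (\<lambda>i. toM (h' i))" "\<forall>A\<in>S. evalr h' A = 0"
        using h null_ideal_iff by blast
      show "f \<oplus>\<^bsub>UP M2\<^esub> h \<in> null_ideal (toM ` S)"
        unfolding f'(2) h'(2) add_UP_M2[OF f'(1) h'(1)]
        using f'(1,3) h'(1,3) by (intro null_idealI finsupp_add) (simp_all add: evalr_add)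
    qed
  qed
qed

section \<open>Scalar matrices, trace and determinant\<close>

definition sc :: "'a::zero \<Rightarrow> 'a m2" where
  "sc c = Mtx c 0 0 c"

fun tr :: "'a::plus m2 \<Rightarrow> 'a" where
  "tr (Mtx a b c d) = a + d"

fun dt :: "'a::comm_ring_1 m2 \<Rightarrow> 'a" where
  "dt (Mtx a b c d) = a * d - b * c"

text \<open>This is the minimal polynomial class of x^2 - s x + d, as
  \<open>is_min_poly_nonscalar_iff\<close> confirms.\<close>

definition nonscalar :: "'a::comm_ring_1 \<Rightarrow> 'a \<Rightarrow> 'a m2 set" where
  "nonscalar s d = {A. A \<notin> range sc \<and> tr A = s \<and> dt A = d}"

lemma sc_simps: "sc 0 = 0" "sc 1 = 1" "sc a + sc b = sc (a + b)" "sc a * sc b = sc (a * b)"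
  "sc a - sc b = sc (a - b)" "- sc a = sc (- a)" "sc a = sc b \<longleftrightarrow> a = b"
  for a b :: "'a::comm_ring_1"
  by (auto simp: sc_def zero_m2_def one_m2_def)

lemma sc_eq_0_iff: "sc a = 0 \<longleftrightarrow> a = 0" for a :: "'a::comm_ring_1"
  by (simp add: sc_def zero_m2_def)

lemma sc_commute: "sc a * B = B * sc a" for a :: "'a::comm_ring_1"
  by (cases B) (simp add: sc_def mult.commute)

lemma sc_power: "sc a ^ n = sc (a ^ n)" for a :: "'a::comm_ring_1"
  by (induction n) (auto simp: sc_simps)

lemma cayley_hamilton: "A * A = sc (tr A) * A - sc (dt A)"
  by (cases A) (simp add: sc_def algebra_simps)

lemma dt_mult: "dt (A * B) = dt A * dt B"
  by (cases A; cases B) (simp add: algebra_simps)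

text \<open>Multiplication by the adjugate of \<open>Y\<close> turns \<open>X * Y = 0\<close> into
  \<open>X * sc (dt Y) = 0\<close>.\<close>

lemma mult_right_cancel_dt:
  fixes X Y :: "'a::field m2"
  assumes "X * Y = 0" "dt Y \<noteq> 0"
  shows "X = 0"
proof -
  obtain a b c d where Y: "Y = Mtx a b c d"
    by (cases Y)
  have "Y * Mtx d (- b) (- c) a = sc (dt Y)"
    by (simp add: Y sc_def algebra_simps)
  then have "X * sc (dt Y) = 0"
    using assms(1) by (metis mult.assoc mult_zero_left)
  then show ?thesis
    using assms(2) by (cases X) (simp add: sc_def zero_m2_def)
qed

text \<open>Linear independence of the identity and a nonscalar matrix over the field.\<close>

lemma not_scalar_linear:
  fixes A :: "'a::field m2"
  assumes "A \<notin> range sc" "sc p * A = sc r"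
  shows "p = 0" "r = 0"
proof -
  obtain a b c d where A: "A = Mtx a b c d"
    by (cases A)
  have eq: "p * a = r" "p * d = r" "p * b = 0" "p * c = 0"
    using assms(2) by (simp_all add: A sc_def)
  show "p = 0"
  proof (rule ccontr)
    assume "p \<noteq> 0"
    moreover from this have "a = d"
      using eq by (metis mult_left_cancel)
    ultimately have "A = sc a"
      using eq by (simp add: A sc_def)
    then show False
      using assms(1) by blast
  qed
  then show "r = 0"
    using eq by simp
qed

section \<open>Minimal polynomial classes\<close>

definition evalp :: "'a::comm_ring_1 poly \<Rightarrow> 'a m2 \<Rightarrow> 'a m2" where
  "evalp p A = (\<Sum>i\<le>degree p. sc (coeff p i) * A ^ i)"

lemma toM_smult: "c \<cdot>\<^sub>m toM A = toM (sc c * A)"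
  by (cases A) (rule eq_matI, auto simp: sc_def)

lemma poly_at_mat_toM: "poly_at_mat p (toM A) = toM (evalp p A)"
  unfolding poly_at_mat_def evalp_def
  by (simp add: toM_sum flip: toM_smult toM_power)

lemma is_min_poly_toM: "is_min_poly m (toM A) \<longleftrightarrow>
  lead_coeff m = 1 \<and> evalp m A = 0 \<and> (\<forall>p. p \<noteq> 0 \<and> evalp p A = 0 \<longrightarrow> degree m \<le> degree p)"
proof -
  have z: "\<zero>\<^bsub>M2\<^esub> = toM 0"
    by (simp add: ring_mat_simps toM_zero)
  show ?thesis
    unfolding is_min_poly_def poly_at_mat_toM z toM_eq_iff ..
qed

lemma evalp_quadratic:
  assumes "degree p \<le> 2"
  shows "evalp p A = sc (coeff p 0) + sc (coeff p 1) * A + sc (coeff p 2) * (A * A)"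
proof -
  have "evalp p A = (\<Sum>i\<le>2. sc (coeff p i) * A ^ i)"
    unfolding evalp_def
    by (rule sum.mono_neutral_left) (use assms in \<open>auto simp: coeff_eq_0 sc_simps\<close>)
  then show ?thesis
    by (simp add: numeral_2_eq_2 atMost_Suc algebra_simps)
qed

lemma poly_degree_1_eq: "degree p \<le> 1 \<Longrightarrow> p = [:coeff p 0, coeff p 1:]"
  by (rule poly_eqI) (auto simp: coeff_pCons coeff_eq_0 split: nat.split)

lemma poly_degree_2_eq: "degree p \<le> 2 \<Longrightarrow> p = [:coeff p 0, coeff p 1, coeff p 2:]"
  by (rule poly_eqI) (auto simp: coeff_pCons coeff_eq_0 numeral_2_eq_2 split: nat.split)

lemma evalp_linear_nonzero:
  fixes A :: "'a::field m2"
  assumes "A \<notin> range sc" "evalp p A = 0" "p \<noteq> 0"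
  shows "degree p \<ge> 2"
proof (rule ccontr)
  assume "\<not> degree p \<ge> 2"
  then have deg: "degree p \<le> 1"
    by simp
  then have "sc (coeff p 0) + sc (coeff p 1) * A = 0"
    using assms(2) by (simp add: evalp_quadratic coeff_eq_0 sc_simps)
  then have "sc (coeff p 1) * A = sc (- coeff p 0)"
    by (simp add: eq_neg_iff_add_eq_0 add.commute flip: sc_simps)
  then have "coeff p 1 = 0" "coeff p 0 = 0"
    using not_scalar_linear[OF assms(1)] by fastforce+
  then show False
    using assms(3) poly_degree_1_eq[OF deg] by simp
qed

lemma evalp_char_poly: "evalp [:dt A, - tr A, 1:] A = 0"
  by (simp add: evalp_quadratic cayley_hamilton numeral_2_eq_2)
     (simp add: sc_simps flip: sc_simps(6))

text \<open>The characteristic polynomial kills \<open>A\<close>, and no nonzero polynomial of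
  degree below 2 does. So \<open>m\<close> has degree 2, and its difference from the characteristic
  polynomial would be a linear relation between the identity and \<open>A\<close>.\<close>

lemma is_min_poly_not_scalar:
  fixes A :: "'a::field m2"
  assumes "A \<notin> range sc"
  shows "is_min_poly m (toM A) \<longleftrightarrow> m = [:dt A, - tr A, 1:]"
proof
  assume "m = [:dt A, - tr A, 1:]"
  then show "is_min_poly m (toM A)"
    using evalp_linear_nonzero[OF assms]
    by (auto simp: is_min_poly_toM evalp_char_poly numeral_2_eq_2)
next
  assume m: "is_min_poly m (toM A)"
  have "degree m \<le> degree [:dt A, - tr A, 1:]"
    using m evalp_char_poly[of A] unfolding is_min_poly_toM by (metis pCons_eq_0_iff one_neq_zero)
  then have le: "degree m \<le> 2"
    by simp
  moreover have "degree m \<ge> 2"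
    by (rule evalp_linear_nonzero[OF assms]) (use m in \<open>auto simp: is_min_poly_toM\<close>)
  ultimately have c2: "coeff m 2 = 1"
    using m unfolding is_min_poly_toM by (metis le_antisym)
  have "sc (coeff m 0) + sc (coeff m 1) * A + (sc (tr A) * A - sc (dt A)) = 0"
    using m le c2 unfolding is_min_poly_toM by (simp add: evalp_quadratic sc_simps cayley_hamilton)
  then have "sc (coeff m 1 + tr A) * A = sc (dt A - coeff m 0)"
    by (simp add: algebra_simps flip: sc_simps)
  then have "coeff m 1 + tr A = 0" "dt A - coeff m 0 = 0"
    using not_scalar_linear[OF assms] by blast+
  then have c01: "coeff m 1 = - tr A" "coeff m 0 = dt A"
    by (simp_all add: eq_neg_iff_add_eq_0)
  have "m = [:coeff m 0, coeff m 1, coeff m 2:]"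
    using le by (rule poly_degree_2_eq)
  then show "m = [:dt A, - tr A, 1:]"
    unfolding c01 c2 .
qed

lemma is_min_poly_scalar:
  fixes c :: "'a::field"
  assumes "is_min_poly m (toM (sc c))"
  shows "m = [:- c, 1:]"
proof -
  have "evalp [:- c, 1:] (sc c) = 0"
    by (simp add: evalp_quadratic numeral_2_eq_2 sc_simps)
  then have "degree m \<le> degree [:- c, 1:]"
    using assms unfolding is_min_poly_toM by (metis pCons_eq_0_iff one_neq_zero)
  then have le: "degree m \<le> 1"
    by simp
  then have *: "coeff m 0 + coeff m 1 * c = 0"
    using assms unfolding is_min_poly_toM
    by (simp add: evalp_quadratic sc_simps coeff_eq_0 sc_eq_0_iff)
  have c1: "coeff m 1 = 1"
  proof (rule ccontr)
    assume "coeff m 1 \<noteq> 1"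
    then have "degree m \<noteq> 1"
      using assms unfolding is_min_poly_toM by metis
    then have "degree m = 0"
      using le by simp
    then show False
      using assms * unfolding is_min_poly_toM by (simp add: coeff_eq_0)
  qed
  have "m = [:coeff m 0, coeff m 1:]"
    using le by (rule poly_degree_1_eq)
  also have "coeff m 0 = - c"
    using * c1 by (simp add: eq_neg_iff_add_eq_0)
  finally show ?thesis
    using c1 by simp
qed

lemma is_min_poly_nonscalar_iff: "is_min_poly [:d, - s, 1:] (toM A) \<longleftrightarrow> A \<in> nonscalar s d"
  for d s :: "'a::field"
proof (cases "A \<in> range sc")
  case True
  then show ?thesis
    by (auto simp: nonscalar_def dest: is_min_poly_scalar)
next
  case False
  then show ?thesis
    by (auto simp: nonscalar_def is_min_poly_not_scalar)
qed

text \<open>A scalar argument commutes with \<open>B\<close>, so inserting \<open>B\<close>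
  multiplies the value by \<open>B\<close> on the right.\<close>

lemma core_scalar:
  fixes c :: "'a::field"
  assumes "T \<subseteq> {sc c}"
  shows "core_m2 T"
  unfolding core_m2_def
proof (intro allI impI ballI)
  fix g B A
  assume g: "finsupp g \<and> (\<forall>A\<in>T. evalr g A = 0)" and A: "A \<in> T"
  then obtain n where n: "\<And>i. i > n \<Longrightarrow> g i = 0"
    using finsupp_bound by metis
  have "A = sc c"
    using A assms by blast
  then have "evalr (\<lambda>i. g i * B) A = evalr g A * B"
    by (simp add: evalr_eq[of n] n sum_distrib_right sc_power mult.assoc sc_commute)
  then show "evalr (\<lambda>i. g i * B) A = 0"
    using g A by simp
qed

lemma inter_min_poly_class:
  "toM ` S \<inter> min_poly_class m = toM ` {A \<in> S. is_min_poly m (toM A)}"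
  by (auto simp: min_poly_class_def ring_mat_simps)

text \<open>If \<open>m\<close> is the minimal polynomial of some nonscalar matrix, its class is one
  of the sets \<open>nonscalar s d\<close>. Otherwise its class has at most one element, a scalar
  matrix, and all subsets of it are core.\<close>

lemma purely_core_toM:
  fixes S :: "'a::field m2 set"
  shows "purely_core (toM ` S) \<longleftrightarrow> (\<forall>s d. core_m2 (S \<inter> nonscalar s d))"
proof
  assume S: "purely_core (toM ` S)"
  show "\<forall>s d. core_m2 (S \<inter> nonscalar s d)"
  proof (intro allI)
    fix s d :: 'a
    have "{A \<in> S. is_min_poly [:d, - s, 1:] (toM A)} = S \<inter> nonscalar s d"
      by (auto simp: is_min_poly_nonscalar_iff)
    moreover have "core_m2 {A \<in> S. is_min_poly [:d, - s, 1:] (toM A)}"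
      using S by (simp add: purely_core_def inter_min_poly_class flip: core_toM)
    ultimately show "core_m2 (S \<inter> nonscalar s d)"
      by simp
  qed
next
  assume S: "\<forall>s d. core_m2 (S \<inter> nonscalar s d)"
  have "core_m2 {A \<in> S. is_min_poly m (toM A)}" for m :: "'a poly"
  proof (cases "\<exists>A. A \<notin> range sc \<and> is_min_poly m (toM A)")
    case True
    then obtain B where B: "m = [:dt B, - tr B, 1:]"
      using is_min_poly_not_scalar by blast
    have "{A \<in> S. is_min_poly m (toM A)} = S \<inter> nonscalar (tr B) (dt B)"
      unfolding B by (auto simp: is_min_poly_nonscalar_iff)
    then show ?thesis
      using S by simp
  next
    case False
    \<comment> \<open>A scalar \<open>sc c\<close> in the class forces m = x - c, so
      \<open>c\<close> can be read off from the constant coefficient.\<close>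
    have "{A \<in> S. is_min_poly m (toM A)} \<subseteq> {sc (- coeff m 0)}"
      using False is_min_poly_scalar by force
    then show ?thesis
      by (rule core_scalar)
  qed
  then show "purely_core (toM ` S)"
    by (simp add: purely_core_def inter_min_poly_class core_toM)
qed

section \<open>Core sets and their intersections with minimal polynomial classes\<close>

text \<open>Reduction of x^i modulo x^2 - s x + d. The quantifier order matters: \<open>p\<close>
  and \<open>r\<close> serve all matrices with this trace and determinant at once.\<close>

lemma power_nonscalar:
  fixes s d :: "'a::comm_ring_1"
  shows "\<exists>p r. \<forall>i A. tr A = s \<and> dt A = d \<longrightarrow> A ^ i = sc (p i) * A + sc (r i)"
proof -
  have "\<exists>p r. \<forall>A. tr A = s \<and> dt A = d \<longrightarrow> A ^ i = sc p * A + sc r" for i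
  proof (induction i)
    case 0
    show ?case
      by (rule exI[of _ 0], rule exI[of _ 1]) (simp add: sc_simps)
  next
    case (Suc i)
    then obtain p r where *: "\<And>A. tr A = s \<and> dt A = d \<Longrightarrow> A ^ i = sc p * A + sc r"
      by blast
    have "A ^ Suc i = sc (p * s + r) * A + sc (- p * d)" if "tr A = s \<and> dt A = d" for A
    proof -
      have "A ^ Suc i = sc p * (A * A) + sc r * A"
        using * that by (simp add: power_Suc2 algebra_simps del: power_Suc)
      also have "A * A = sc s * A - sc d"
        using that cayley_hamilton[of A] by simp
      also have "sc p * (sc s * A - sc d) + sc r * A = sc (p * s + r) * A + sc (- p * d)"
        by (cases A) (simp add: sc_def algebra_simps)
      finally show ?thesis .
    qed
    then show ?case
      by blast
  qed
  then have "\<forall>i. \<exists>p r. \<forall>A. tr A = s \<and> dt A = d \<longrightarrow> A ^ i = sc p * A + sc r"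
    by blast
  then show ?thesis
    by metis
qed

text \<open>A polynomial witnessing that \<open>T\<close> is noncore has a linear remainder P x + R
  modulo x^2 - s x + d. Since P A = -R for all \<open>A\<close> in \<open>T\<close>, the product P A
  is constant on \<open>T\<close>; and P = 0 would give R = 0, so that inserting \<open>B\<close>
  could never produce a nonzero value.\<close>

lemma noncore_annihilator:
  fixes T :: "'a::field m2 set"
  assumes T: "T \<subseteq> nonscalar s d" and nc: "\<not> core_m2 T"
  shows "\<exists>\<alpha> A0. A0 \<in> T \<and> \<alpha> \<noteq> 0 \<and> (\<forall>A\<in>T. \<alpha> * A = \<alpha> * A0)"
proof -
  obtain g B A0 where g: "finsupp g" "\<And>A. A \<in> T \<Longrightarrow> evalr g A = 0"
    and A0: "A0 \<in> T" "evalr (\<lambda>i. g i * B) A0 \<noteq> 0"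
    using nc unfolding core_m2_def by blast
  obtain n where n: "\<And>i. i > n \<Longrightarrow> g i = 0"
    using g finsupp_bound by metis
  obtain p r where pr: "\<And>i A. tr A = s \<and> dt A = d \<Longrightarrow> A ^ i = sc (p i) * A + sc (r i)"
    using power_nonscalar[of s d] by blast
  define P where "P = (\<Sum>i\<le>n. g i * sc (p i))"
  define R where "R = (\<Sum>i\<le>n. g i * sc (r i))"
  have ev: "evalr (\<lambda>i. g i * B) A = P * B * A + R * B" if "A \<in> T" for A B
  proof -
    have *: "tr A = s \<and> dt A = d"
      using that T by (auto simp: nonscalar_def)
    \<comment> \<open>The remainder coefficients of the powers are scalar and pass through
      \<open>B\<close>; hence inserting \<open>B\<close> into \<open>g\<close> inserts it into the
      remainder.\<close>
    have "g i * B * (sc (p i) * A) = g i * sc (p i) * B * A"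
      "g i * B * sc (r i) = g i * sc (r i) * B" for i
      by (metis mult.assoc sc_commute)+
    then show ?thesis
      by (simp add: evalr_eq[of n] n pr[OF *] P_def R_def sum_distrib_right sum.distrib
          distrib_left)
  qed
  have PR: "P * A + R = 0" if "A \<in> T" for A
    using ev[OF that, of 1] g that by simp
  have "P \<noteq> 0"
  proof
    assume "P = 0"
    moreover from this have "R = 0"
      using PR[OF A0(1)] by simp
    ultimately show False
      using A0 ev by simp
  qed
  moreover have "P * A = P * A0" if "A \<in> T" for A
    using PR[OF that] PR[OF A0(1)] by (metis add_right_cancel)
  ultimately show ?thesis
    using A0 by blast
qed

text \<open>With \<alpha> from \<open>noncore_annihilator\<close>, either \<alpha> (A0 - b) = 0 and
  \<beta> = \<alpha> works for the eigenvalue \<open>b\<close>, or \<beta> = \<alpha> (A0 - b) is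
  nonzero and works for \<open>a\<close>, because (A - b)(A - a) = 0. The nonzero rows of \<beta>
  are common left eigenvectors. The case a = b is included and serves the double roots.\<close>

lemma noncore_split:
  fixes T :: "'a::field m2 set"
  assumes T: "T \<subseteq> nonscalar (a + b) (a * b)" and nc: "\<not> core_m2 T"
  shows "\<exists>\<beta> l. T \<noteq> {} \<and> \<beta> \<noteq> 0 \<and> l \<in> {a, b} \<and> (\<forall>A\<in>T. \<beta> * A = \<beta> * sc l)"
proof -
  from noncore_annihilator[OF T nc] obtain \<alpha> A0
    where A0: "A0 \<in> T" "\<alpha> \<noteq> 0" and \<alpha>': "\<forall>A\<in>T. \<alpha> * A = \<alpha> * A0"
    by (elim exE conjE)
  have \<alpha>: "\<alpha> * A = \<alpha> * A0" if "A \<in> T" for A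
    using \<alpha>' that by (rule bspec)
  show ?thesis
  proof (cases "\<alpha> * A0 = \<alpha> * sc b")
    case True
    have "\<alpha> * A = \<alpha> * sc b" if "A \<in> T" for A
      using \<alpha>[OF that] True by simp
    then show ?thesis
      using A0 by (intro exI[of _ \<alpha>] exI[of _ b]) auto
  next
    case False
    have "(\<alpha> * A0 - \<alpha> * sc b) * A = (\<alpha> * A0 - \<alpha> * sc b) * sc a" if "A \<in> T" for A
    proof -
      have AA: "A * A = sc (a + b) * A - sc (a * b)"
        using T that cayley_hamilton[of A] by (auto simp: nonscalar_def)
      have "(\<alpha> * A0 - \<alpha> * sc b) * A = \<alpha> * A * A - \<alpha> * sc b * A"
        by (simp add: left_diff_distrib \<alpha>[OF that])
      also have "\<dots> = \<alpha> * (A * A - sc b * A)"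
        by (simp add: algebra_simps)
      also have "\<dots> = \<alpha> * ((A - sc b) * sc a)"
        unfolding AA by (cases A) (simp add: sc_def algebra_simps)
      also have "\<dots> = (\<alpha> * A - \<alpha> * sc b) * sc a"
        by (simp add: algebra_simps)
      also have "\<alpha> * A = \<alpha> * A0"
        by (rule \<alpha>[OF that])
      finally show ?thesis .
    qed
    then show ?thesis
      using A0 False by (intro exI[of _ "\<alpha> * A0 - \<alpha> * sc b"] exI[of _ a]) auto
  qed
qed

section \<open>Central quadratics that kill the other classes\<close>

definition quad :: "'a::comm_ring_1 \<times> 'a \<Rightarrow> 'a m2 \<Rightarrow> 'a m2" where
  "quad p A = A * A - sc (fst p) * A + sc (snd p)"

definition quads :: "('a::comm_ring_1 \<times> 'a) list \<Rightarrow> 'a m2 \<Rightarrow> 'a m2" where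
  "quads L A = prod_list (map (\<lambda>p. quad p A) L)"

text \<open>Central coefficients commute with \<open>B\<close> and with all other coefficients, so
  evaluation is multiplicative in this factor.\<close>

lemma evalr_conv_central:
  fixes g h :: "nat \<Rightarrow> 'a::comm_ring_1 m2"
  assumes g: "finsupp g" and h: "finsupp h" "\<And>i. h i \<in> range sc"
  shows "evalr (\<lambda>i. conv g h i * B) A = evalr (\<lambda>i. g i * B) A * evalr h A"
proof -
  have c: "h i * X = X * h i" for i X
    using h(2)[of i] by (auto simp: sc_commute)
  have gB: "finsupp (\<lambda>i. g i * B)"
    using g by (rule finsupp_compose) simp
  have hj: "evalr (\<lambda>i. g i * B * h j) A = evalr (\<lambda>i. g i * B) A * h j" for j
  proof -
    obtain n where "\<And>i. i > n \<Longrightarrow> g i = 0"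
      using g finsupp_bound by metis
    then show ?thesis
      by (simp add: evalr_eq[of n] sum_distrib_right mult.assoc c)
  qed
  have "(\<lambda>i. conv g h i * B) = conv (\<lambda>i. g i * B) h"
    by (simp add: conv_def sum_distrib_right mult.assoc c fun_eq_iff)
  then have "evalr (\<lambda>i. conv g h i * B) A =
      (\<Sum>j | h j \<noteq> 0. evalr (\<lambda>i. g i * B * h j) A * A ^ j)"
    using conv_finsupp_evalr(2)[OF gB h(1)] by simp
  then show ?thesis
    by (simp add: hj evalr_def[of h] sum_distrib_left flip: mult.assoc)
qed

text \<open>By the assumption, \<open>g\<close> times the quadratics of \<open>L\<close> lies in the
  null ideal. A core \<open>S\<close> allows \<open>B\<close> to be inserted, and the central
  quadratics then factor out again. The induction absorbs them into \<open>g\<close> one at a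
  time.\<close>

lemma core_quads:
  fixes g :: "nat \<Rightarrow> 'a::comm_ring_1 m2"
  assumes "core_m2 S" "finsupp g" "\<And>A. A \<in> S \<Longrightarrow> evalr g A * quads L A = 0" "A \<in> S"
  shows "evalr (\<lambda>i. g i * B) A * quads L A = 0"
  using assms(2,3)
proof (induction L arbitrary: g)
  case Nil
  then show ?case
    using assms(1,4) unfolding core_m2_def by (auto simp: quads_def)
next
  case (Cons p L)
  define h where "h = (\<lambda>i::nat. if i = 0 then sc (snd p) else if i = 1 then sc (- fst p)
    else if i = 2 then sc 1 else 0)"
  have h0: "h i = 0" if "i > 2" for i
    using that by (simp add: h_def)
  have h: "finsupp h" "h i \<in> range sc" for i
    by (rule finsuppI[OF h0]) (auto simp: h_def simp flip: sc_simps(1))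
  have "evalr h A = quad p A" for A
    using evalr_eq[of 2 h A] h0
    by (simp add: h_def quad_def numeral_2_eq_2 sc_simps(2) flip: sc_simps(6))
  then have eq: "evalr (\<lambda>i. conv g h i * B) A * quads L A = evalr (\<lambda>i. g i * B) A * quads (p # L) A" for A B
    using Cons.prems(1) h by (simp add: evalr_conv_central quads_def mult.assoc)
  have "evalr (conv g h) A * quads L A = 0" if "A \<in> S" for A
    using eq[of 1 A] Cons.prems(2)[OF that] by simp
  then have "evalr (\<lambda>i. conv g h i * B) A * quads L A = 0"
    using Cons.prems(1) h by (intro Cons.IH conv_finsupp_evalr(1))
  then show ?case
    using eq by simp
qed

lemma quads_eq_0:
  assumes "p \<in> set L" "quad p A = 0"
  shows "quads L A = 0"
  using assms by (auto simp: quads_def dest!: split_list)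

lemma dt_quads:
  fixes A :: "'a::idom m2"
  shows "dt (quads L A) = 0 \<longleftrightarrow> (\<exists>p\<in>set L. dt (quad p A) = 0)"
proof (induction L)
  case Nil
  show ?case
    by (simp add: quads_def one_m2_def)
qed (auto simp: quads_def dt_mult)

text \<open>For nonzero \<open>p\<close> this is p^2 times the characteristic polynomial of
  \<open>A\<close> at -r/p. Together with \<open>quad_eq_linear\<close> it decides where a central
  quadratic is invertible.\<close>

lemma dt_linear: "dt (sc p * A + sc r) = p\<^sup>2 * dt A + p * r * tr A + r\<^sup>2"
  by (cases A) (simp add: sc_def algebra_simps power2_eq_square)

lemma quad_eq_linear: "quad p A = sc (tr A - fst p) * A + sc (snd p - dt A)"
  by (simp add: quad_def cayley_hamilton algebra_simps flip: sc_simps)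

lemma quad_char: "quad (tr A, dt A) A = 0"
  by (simp add: quad_eq_linear sc_simps)

text \<open>Three matrix units in place of \<open>B\<close> already force the off-diagonal entries
  of \<open>A\<close> to vanish and the diagonal ones to agree.\<close>

lemma scalar_if_sandwich:
  fixes A :: "'a::field m2"
  assumes "\<alpha> \<noteq> 0" "\<And>B. \<alpha> * B * A = \<alpha> * A * B"
  shows "A \<in> range sc"
proof -
  obtain a b c d where \<alpha>: "\<alpha> = Mtx a b c d" by (cases \<alpha>)
  obtain e f g h where A: "A = Mtx e f g h" by (cases A)
  have "a * f = 0" "c * f = 0" "b * g = 0" "d * g = 0"
    using assms(2)[of "Mtx 1 0 0 0"] by (simp_all add: \<alpha> A)
  moreover have "a * g = 0" "c * g = 0" "a * h = a * e + b * g" "c * h = c * e + d * g"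
    using assms(2)[of "Mtx 0 1 0 0"] by (simp_all add: \<alpha> A)
  moreover have "b * f = 0" "d * f = 0" "b * e = a * f + b * h" "d * e = c * f + d * h"
    using assms(2)[of "Mtx 0 0 1 0"] by (simp_all add: \<alpha> A)
  moreover have "a \<noteq> 0 \<or> b \<noteq> 0 \<or> c \<noteq> 0 \<or> d \<noteq> 0"
    using assms(1) by (auto simp: \<alpha> zero_m2_def)
  ultimately have "f = 0" "g = 0" "e = h"
    by auto
  then show ?thesis
    by (simp add: A sc_def)
qed

text \<open>The polynomial \<alpha> x - \<alpha> A0 kills the part in the class, and the quadratics
  of all other pairs kill the rest of \<open>S\<close>. Their product is invertible at
  \<open>A0\<close> and can be cancelled after inserting \<open>B\<close>, leaving \<alpha> B A0 =
  \<alpha> A0 B for all \<open>B\<close>, which makes \<open>A0\<close> scalar.\<close>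

lemma core_inter_irreducible:
  fixes S :: "'a::{field,finite} m2 set"
  assumes S: "core_m2 S" and irr: "\<And>x. x\<^sup>2 - s * x + d \<noteq> 0"
  shows "core_m2 (S \<inter> nonscalar s d)"
proof (rule ccontr)
  assume "\<not> core_m2 (S \<inter> nonscalar s d)"
  from noncore_annihilator[OF Int_lower2 this] obtain \<alpha> A0
    where A0: "A0 \<in> S \<inter> nonscalar s d" "\<alpha> \<noteq> 0"
      and \<alpha>: "\<forall>A\<in>S \<inter> nonscalar s d. \<alpha> * A = \<alpha> * A0"
    by (elim exE conjE)
  obtain L where L: "set L = UNIV - {(s, d)}"
    using finite_list[of "UNIV - {(s, d)}"] by auto
  define g where "g = (\<lambda>i::nat. if i = 0 then - \<alpha> * A0 else if i = 1 then \<alpha> else 0)"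
  have g0: "g i = 0" if "i > 1" for i
    using that by (simp add: g_def)
  have g: "finsupp g"
    by (rule finsuppI[OF g0])
  have ev: "evalr (\<lambda>i. g i * B) A = \<alpha> * B * A - \<alpha> * A0 * B" for A B
    using evalr_eq[of 1 "\<lambda>i. g i * B" A] g0 by (simp add: g_def)
  have "evalr g A * quads L A = 0" if "A \<in> S" for A
  proof (cases "tr A = s \<and> dt A = d")
    case True
    have "A \<notin> range sc"
    proof
      assume "A \<in> range sc"
      then obtain x where "A = sc x"
        by blast
      then show False
        using irr[of x] True by (auto simp: sc_def algebra_simps power2_eq_square)
    qed
    then show ?thesis
      using ev[of 1 A] bspec[OF \<alpha>, of A] that True by (simp add: nonscalar_def)
  next
    case False
    then show ?thesis
      using quads_eq_0[of "(tr A, dt A)" L A] L quad_char[of A] by auto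
  qed
  from core_quads[OF S g this] have 0: "evalr (\<lambda>i. g i * B) A0 * quads L A0 = 0" for B
    using A0 by blast
  have "dt (quads L A0) \<noteq> 0"
    unfolding dt_quads
  proof safe
    fix u w assume "(u, w) \<in> set L" and z: "dt (quad (u, w) A0) = 0"
    then have uw: "s - u \<noteq> 0 \<or> w - d \<noteq> 0"
      using L by auto
    have "tr A0 = s" "dt A0 = d"
      using A0 by (auto simp: nonscalar_def)
    then have z: "(s - u)\<^sup>2 * d + (s - u) * (w - d) * s + (w - d)\<^sup>2 = 0"
      using z by (simp add: quad_eq_linear dt_linear)
    \<comment> \<open>If s = u, the determinant is (w - d)^2 with w different from d. Otherwise it
      is (s - u)^2 times the value of x^2 - s x + d at -(w - d)/(s - u), which is nonzero by
      irreducibility.\<close>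
    show False
    proof (cases "s - u = 0")
      case True
      then show ?thesis
        using uw z by simp
    next
      case False
      have "e\<^sup>2 * ((- r / e)\<^sup>2 - s * (- r / e) + d) = e\<^sup>2 * d + e * r * s + r\<^sup>2" if "e \<noteq> 0" for e r
        using that by (simp add: field_simps power2_eq_square)
      from this[OF False] show ?thesis
        using z False irr by (metis mult_eq_0_iff power_not_zero)
    qed
  qed
  then have "\<alpha> * B * A0 - \<alpha> * A0 * B = 0" for B
    using mult_right_cancel_dt[OF 0] ev by simp
  then have "A0 \<in> range sc"
    using scalar_if_sandwich[OF A0(2)] by simp
  then show False
    using A0 by (auto simp: nonscalar_def)
qed

text \<open>Here \<beta> (x - a) kills the part in the class, and \<open>L\<close> may only contain
  quadratics that do not vanish at \<open>a\<close>, to be invertible at \<open>A0\<close>. A matrix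
  whose characteristic polynomial vanishes at \<open>a\<close> is therefore not killed by its own
  quadratic: for (x - a)(x - b) with b different from \<open>a\<close>, the factor x - a is combined
  with (x - b)^2 from \<open>L\<close>.\<close>

lemma core_inter_double_root:
  fixes S :: "'a::{field,finite} m2 set"
  assumes S: "core_m2 S"
  shows "core_m2 (S \<inter> nonscalar (a + a) (a * a))"
proof (rule ccontr)
  let ?T = "S \<inter> nonscalar (a + a) (a * a)"
  assume "\<not> core_m2 ?T"
  from noncore_split[OF Int_lower2 this] obtain \<beta> l
    where "?T \<noteq> {}" and \<beta>0: "\<beta> \<noteq> 0" and l: "l \<in> {a, a}"
      and \<beta>: "\<forall>A\<in>?T. \<beta> * A = \<beta> * sc l"
    by (elim exE conjE)
  then obtain A0 where A0: "A0 \<in> ?T"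
    by blast
  obtain L where L: "set L = {(u, w). a\<^sup>2 - u * a + w \<noteq> 0}"
    using finite_list[of "{(u, w). a\<^sup>2 - u * a + w \<noteq> 0}"] by auto
  define g where "g = (\<lambda>i::nat. if i = 0 then - (\<beta> * sc a) else if i = 1 then \<beta> else 0)"
  have g0: "g i = 0" if "i > 1" for i
    using that by (simp add: g_def)
  have g: "finsupp g"
    by (rule finsuppI[OF g0])
  have ev: "evalr (\<lambda>i. g i * B) A = \<beta> * B * (A - sc a)" for A B
    using evalr_eq[of 1 "\<lambda>i. g i * B" A] g0
    by (simp add: g_def algebra_simps sc_commute[of a B])
  have "evalr g A * quads L A = 0" if "A \<in> S" for A
  proof (cases "(tr A, dt A) \<in> set L")
    case True
    then show ?thesis
      using quads_eq_0 quad_char by (metis mult_zero_right)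
  next
    case False
    define b where "b = tr A - a"
    have t: "tr A = a + b" and d: "dt A = a * b"
      using False by (auto simp: L b_def algebra_simps power2_eq_square)
    have "(A - sc a) * quads L A = 0"
      if "b \<noteq> a"
    proof -
      have "(b + b, b * b) \<in> set L"
      proof -
        have "a\<^sup>2 - (b + b) * a + b * b = (b - a)\<^sup>2"
          by (simp add: algebra_simps power2_eq_square)
        then show ?thesis
          using that by (simp add: L)
      qed
      then obtain L1 L2 where L12: "L = L1 @ (b + b, b * b) # L2"
        by (auto dest: split_list)
      \<comment> \<open>Moves A - a past the leading factors to the quadratic that it
        annihilates.\<close>
      have comm: "(A - sc a) * quads M A = quads M A * (A - sc a)" for M
      proof (induction M)
        case (Cons p M)
        have "(A - sc a) * quad p A = quad p A * (A - sc a)"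
          by (cases A) (simp add: quad_def sc_def algebra_simps)
        then show ?case
          using Cons by (simp add: quads_def) (metis mult.assoc)
      qed (simp add: quads_def)
      have AA: "A * A = sc (a + b) * A - sc (a * b)"
        using cayley_hamilton[of A] t d by simp
      have "(A - sc a) * (A - sc b) = A * A - (sc (a + b) * A - sc (a * b))"
        by (cases A) (simp add: sc_def algebra_simps)
      then have "(A - sc a) * (A - sc b) = 0"
        by (simp add: AA)
      moreover have "quad (b + b, b * b) A = (A - sc b) * (A - sc b)"
        by (cases A) (simp add: quad_def sc_def algebra_simps)
      ultimately have "(A - sc a) * quad (b + b, b * b) A = 0"
        by (metis mult.assoc mult_zero_left)
      moreover have "(A - sc a) * quads L A =
          quads L1 A * ((A - sc a) * quad (b + b, b * b) A) * quads L2 A"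
      proof -
        have "quads L A = quads L1 A * quad (b + b, b * b) A * quads L2 A"
          by (simp add: L12 quads_def mult.assoc)
        then show ?thesis
          using comm[of L1] by (metis mult.assoc)
      qed
      ultimately show ?thesis
        by simp
    qed
    moreover have "evalr g A = 0" if "b = a"
    proof (cases "A \<in> range sc")
      case True
      then obtain x where x: "A = sc x"
        by blast
      \<comment> \<open>Both equations enter: in characteristic 2 the trace says nothing about
        \<open>x\<close>.\<close>
      have "x + x = a + a" "x * x = a * a"
        using t d that by (simp_all only: x sc_def tr.simps dt.simps) simp_all
      moreover have "(x - a)\<^sup>2 = x * x - (x + x) * a + a * a"
        by (simp add: algebra_simps power2_eq_square)
      ultimately have "(x - a)\<^sup>2 = 0"
        by (simp only:) (simp add: algebra_simps)
      then show ?thesis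
        using ev[of 1 A] x by simp
    next
      case False
      then have "A \<in> ?T"
        using t d that \<open>A \<in> S\<close> by (simp add: nonscalar_def)
      then show ?thesis
        using ev[of 1 A] bspec[OF \<beta>, of A] l by (simp add: right_diff_distrib)
    qed
    ultimately show ?thesis
      using ev[of 1 A] by (cases "b = a") (auto simp: mult.assoc)
  qed
  from core_quads[OF S g this] have 0: "evalr (\<lambda>i. g i * B) A0 * quads L A0 = 0" for B
    using A0 by blast
  \<comment> \<open>As \<open>A0\<close> has the double eigenvalue \<open>a\<close>, the determinant
    of a quadratic at \<open>A0\<close> is the square of its value at \<open>a\<close>.\<close>
  have "dt (quads L A0) \<noteq> 0"
    unfolding dt_quads
  proof safe
    fix u w assume uw: "(u, w) \<in> set L" and z: "dt (quad (u, w) A0) = 0"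
    have A0': "tr A0 = a + a" "dt A0 = a * a"
      using A0 by (auto simp: nonscalar_def)
    have "(a\<^sup>2 - u * a + w)\<^sup>2 = dt (quad (u, w) A0)"
      unfolding quad_eq_linear dt_linear A0' fst_conv snd_conv
      by (simp add: algebra_simps power2_eq_square)
    then show False
      using uw z by (simp add: L)
  qed
  then have 0: "\<beta> * B * (A0 - sc a) = 0" for B
    using mult_right_cancel_dt[OF 0] ev by simp
  have "\<beta> * B * (A0 - sc a) = \<beta> * (A0 - sc a) * B" for B
    using 0[of B] 0[of 1] by simp
  then have "A0 - sc a \<in> range sc"
    using scalar_if_sandwich[OF \<beta>0] by blast
  then obtain x where "A0 - sc a = sc x"
    by blast
  then have "A0 = sc (x + a)"
    by (metis diff_add_cancel sc_simps(3))
  then show False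
    using A0 by (auto simp: nonscalar_def)
qed

section \<open>Counting\<close>

text \<open>The union of the classes of (x - a)(x - b) with distinct roots; by
  \<open>nonscalar_split\<close> no scalar matrix satisfies the condition.\<close>

definition split_mats :: "'a::comm_ring_1 m2 set" where
  "split_mats = {A. \<exists>a b. a \<noteq> b \<and> tr A = a + b \<and> dt A = a * b}"

definition purely_core_m2 :: "'a::comm_ring_1 m2 set \<Rightarrow> bool" where
  "purely_core_m2 S \<longleftrightarrow> (\<forall>s d. core_m2 (S \<inter> nonscalar s d))"

lemma core_m2_empty: "core_m2 {}"
  by (simp add: core_m2_def)

lemma nonscalar_split:
  fixes a b :: "'a::field"
  assumes "a \<noteq> b"
  shows "nonscalar (a + b) (a * b) = {A. tr A = a + b \<and> dt A = a * b}"
proof -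
  have "A \<notin> range sc" if A: "tr A = a + b" "dt A = a * b" for A
  proof
    assume "A \<in> range sc"
    then obtain x where "A = sc x"
      by blast
    then have x: "x + x = a + b" "x * x = a * b"
      using A by (simp_all only: sc_def tr.simps dt.simps) simp_all
    have "(x - a) * (x - b) = x * x - x * (a + b) + a * b"
      by (simp add: algebra_simps)
    also have "\<dots> = 0"
      by (simp add: x(2)[symmetric] x(1)[symmetric] algebra_simps)
    finally have "x = a \<or> x = b"
      by simp
    then show False
      using x(1) assms by auto
  qed
  then show ?thesis
    by (auto simp: nonscalar_def)
qed

lemma nonscalar_subset_split_mats:
  assumes "a \<noteq> b" "s = a + b" "d = a * b"
  shows "nonscalar s d \<subseteq> split_mats"
  using assms by (auto simp: nonscalar_def split_mats_def)

lemma nonscalar_disjoint_split_mats: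
  assumes "\<nexists>a b. a \<noteq> b \<and> s = a + b \<and> d = a * b"
  shows "nonscalar s d \<inter> split_mats = {}"
  using assms by (auto simp: nonscalar_def split_mats_def)

lemma nonscalar_cases: "nonscalar s d \<subseteq> split_mats \<or> nonscalar s d \<inter> split_mats = {}"
  using nonscalar_subset_split_mats nonscalar_disjoint_split_mats by metis

text \<open>Every class lies inside \<open>split_mats\<close> or is disjoint from it, so the
  condition decouples and purely core sets can be counted as a product.\<close>

lemma purely_core_m2_iff: "purely_core_m2 S \<longleftrightarrow> purely_core_m2 (S \<inter> split_mats) \<and> purely_core_m2 (S - split_mats)"
proof -
  have "core_m2 (S \<inter> nonscalar s d) \<longleftrightarrow>
      core_m2 (S \<inter> split_mats \<inter> nonscalar s d) \<and> core_m2 ((S - split_mats) \<inter> nonscalar s d)" for s d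
    using nonscalar_cases[of s d]
  proof
    assume "nonscalar s d \<subseteq> split_mats"
    then have "S \<inter> split_mats \<inter> nonscalar s d = S \<inter> nonscalar s d" "(S - split_mats) \<inter> nonscalar s d = {}"
      by blast+
    then show ?thesis
      by (simp add: core_m2_empty)
  next
    assume "nonscalar s d \<inter> split_mats = {}"
    then have "S \<inter> split_mats \<inter> nonscalar s d = {}" "(S - split_mats) \<inter> nonscalar s d = S \<inter> nonscalar s d"
      by blast+
    then show ?thesis
      by (simp add: core_m2_empty)
  qed
  then show ?thesis
    unfolding purely_core_m2_def by blast
qed

text \<open>The classes outside \<open>split_mats\<close> have an irreducible polynomial or a double
  root, and both kinds are settled above. A core set can thus fail to be purely core only inside
  \<open>split_mats\<close>.\<close>

lemma core_imp_purely_core_m2_nonsplit: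
  fixes S :: "'a::{field,finite} m2 set"
  assumes "core_m2 S"
  shows "purely_core_m2 (S - split_mats)"
  unfolding purely_core_m2_def
proof (intro allI)
  fix s d :: 'a
  show "core_m2 ((S - split_mats) \<inter> nonscalar s d)"
  proof (cases "\<exists>a b. a \<noteq> b \<and> s = a + b \<and> d = a * b")
    case True
    then have "(S - split_mats) \<inter> nonscalar s d = {}"
      using nonscalar_subset_split_mats by blast
    then show ?thesis
      by (simp add: core_m2_empty)
  next
    case False
    then have eq: "(S - split_mats) \<inter> nonscalar s d = S \<inter> nonscalar s d"
      using nonscalar_disjoint_split_mats by blast
    show ?thesis
    proof (cases "\<exists>x. x\<^sup>2 - s * x + d = 0")
      case True
      then obtain x where x: "x\<^sup>2 - s * x + d = 0"
        by blast
      define y where "y = s - x"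
      have s: "s = x + y"
        by (simp add: y_def)
      have d: "d = x * y"
      proof -
        have "x\<^sup>2 - s * x + d = d - x * y"
          by (simp add: s algebra_simps power2_eq_square)
        then show ?thesis
          using x by simp
      qed
      have "y = x"
        using False s d by metis
      then have "s = x + x" "d = x * x"
        using s d by simp_all
      then show ?thesis
        unfolding eq using core_inter_double_root[OF assms] by simp
    next
      case False
      then show ?thesis
        unfolding eq by (intro core_inter_irreducible assms) blast
    qed
  qed
qed

section \<open>Common left eigenvectors and the sizes of the classes\<close>

text \<open>The type \<open>'a option\<close> parametrises the lines of row vectors: \<open>Some t\<close> is the line of \<open>(1, t)\<close>
  and \<open>None\<close> the line of \<open>(0, 1)\<close>.\<close>

fun eigrow :: "'a::comm_ring_1 option \<Rightarrow> 'a \<Rightarrow> 'a m2 \<Rightarrow> bool" where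
  "eigrow (Some t) l (Mtx a b c d) \<longleftrightarrow> a + t * c = l \<and> b + t * d = l * t"
| "eigrow None l (Mtx a b c d) \<longleftrightarrow> c = 0 \<and> d = l"

text \<open>Any nonzero row (p, r) of \<beta> is a left eigenvector of every such \<open>A\<close>;
  scaling it to (1, r/p) or (0, 1) gives a line independent of \<open>A\<close>.\<close>

lemma eigrow_exists:
  fixes \<beta> :: "'a::field m2"
  assumes "\<beta> \<noteq> 0"
  shows "\<exists>n. \<forall>A. \<beta> * A = \<beta> * sc l \<longrightarrow> eigrow n l A"
proof -
  obtain a b c d where \<beta>: "\<beta> = Mtx a b c d" by (cases \<beta>)
  have row: "\<exists>n. \<forall>e f g h. p * e + r * g = p * l \<and> p * f + r * h = r * l
      \<longrightarrow> eigrow n l (Mtx e f g h)"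
    if "p \<noteq> 0 \<or> r \<noteq> 0" for p r
  proof (cases "p = 0")
    case True
    then show ?thesis
      using that by (intro exI[of _ None]) (auto simp: mult.commute)
  next
    case False
    then show ?thesis
      by (intro exI[of _ "Some (r / p)"]) (auto simp: field_simps)
  qed
  have "a \<noteq> 0 \<or> b \<noteq> 0 \<or> c \<noteq> 0 \<or> d \<noteq> 0"
    using assms by (auto simp: \<beta> zero_m2_def)
  then consider "a \<noteq> 0 \<or> b \<noteq> 0" | "c \<noteq> 0 \<or> d \<noteq> 0"
    by blast
  then show ?thesis
  proof cases
    case 1
    from row[OF this] obtain n where n: "\<And>e f g h. a * e + b * g = a * l \<and> a * f + b * h = b * l
      \<longrightarrow> eigrow n l (Mtx e f g h)" by blast
    have "eigrow n l A" if "\<beta> * A = \<beta> * sc l" for A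
      using that n by (cases A) (simp add: \<beta> sc_def)
    then show ?thesis by blast
  next
    case 2
    from row[OF this] obtain n where n: "\<And>e f g h. c * e + d * g = c * l \<and> c * f + d * h = d * l
      \<longrightarrow> eigrow n l (Mtx e f g h)" by blast
    have "eigrow n l A" if "\<beta> * A = \<beta> * sc l" for A
      using that n by (cases A) (simp add: \<beta> sc_def)
    then show ?thesis by blast
  qed
qed

text \<open>One entry determines the matrix, the others following from the trace and the eigenvector
  equations: the upper right entry for \<open>None\<close>, the lower left one for
  \<open>Some t\<close>.\<close>

lemma card_eigrow:
  fixes a b :: "'a::{field,finite}"
  shows "card (nonscalar (a + b) (a * b) \<inter> {A. eigrow n a A}) \<le> card (UNIV :: 'a set)"
proof (cases n)
  case None
  show ?thesis
  proof (rule card_inj_on_le)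
    show "inj_on (\<lambda>A. case A of Mtx x y z w \<Rightarrow> y) (nonscalar (a + b) (a * b) \<inter> {A. eigrow n a A})"
      by (rule inj_onI) (auto simp: nonscalar_def None split: m2.splits)
  qed auto
next
  case (Some t)
  show ?thesis
  proof (rule card_inj_on_le)
    show "inj_on (\<lambda>A. case A of Mtx x y z w \<Rightarrow> z) (nonscalar (a + b) (a * b) \<inter> {A. eigrow n a A})"
    proof (rule inj_onI)
      fix A B :: "'a m2"
      obtain x y z w where A: "A = Mtx x y z w" by (cases A)
      obtain x' y' z' w' where B: "B = Mtx x' y' z' w'" by (cases B)
      assume AB: "A \<in> nonscalar (a + b) (a * b) \<inter> {A. eigrow n a A}"
        "B \<in> nonscalar (a + b) (a * b) \<inter> {A. eigrow n a A}"
        "(case A of Mtx x y z w \<Rightarrow> z) = (case B of Mtx x y z w \<Rightarrow> z)"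
      then have z: "z = z'"
        by (simp add: A B)
      then have x: "x = x'"
        using AB by (simp add: A B Some) (metis add_right_cancel)
      then have w: "w = w'"
        using AB by (simp add: A B nonscalar_def) (metis add_left_cancel)
      then have "y = y'"
        using AB by (simp add: A B Some) (metis add_right_cancel)
      then show "A = B"
        using x z w by (simp add: A B)
    qed
  qed auto
qed

lemma card_nonscalar_split:
  fixes a b :: "'a::{field,finite}"
  assumes "a \<noteq> b"
  defines "q \<equiv> card (UNIV :: 'a set)"
  shows "q\<^sup>2 + q \<le> card (nonscalar (a + b) (a * b))"
proof -
  \<comment> \<open>With upper right entry y nonzero, \<open>x\<close> and \<open>y\<close> are free
    and the determinant fixes the lower left entry. With y = 0 the diagonal consists of
    \<open>a\<close> and \<open>b\<close> in some order and \<open>z\<close> is free. This gives q(q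
    - 1) + 2q matrices.\<close>
  define f where "f = (\<lambda>(x, y). Mtx x y (- (x - a) * (x - b) / y) (a + b - x))"
  define g where "g = (\<lambda>(x, z). Mtx x 0 z (a + b - x))"
  define P where "P = f ` (UNIV \<times> (UNIV - {0}))"
  define R where "R = g ` ({a, b} \<times> UNIV)"
  have "inj_on f (UNIV \<times> (UNIV - {0}))"
    by (rule inj_on_inverseI[where g = "case_m2 (\<lambda>x y z w. (x, y))"]) (auto simp: f_def)
  moreover have "inj_on g ({a, b} \<times> UNIV)"
    by (rule inj_on_inverseI[where g = "case_m2 (\<lambda>x y z w. (x, z))"]) (auto simp: g_def)
  ultimately have "card P = q * (q - 1)" "card R = 2 * q"
    using assms(1) by (simp_all add: P_def R_def card_image card_cartesian_product q_def
        card_Diff_singleton)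
  moreover have "P \<inter> R = {}"
    by (auto simp: P_def R_def f_def g_def)
  ultimately have "card (P \<union> R) = q * (q - 1) + 2 * q"
    by (simp add: card_Un_disjoint)
  moreover have "q \<noteq> 0"
    by (simp add: q_def)
  then have "q * (q - 1) + 2 * q = q\<^sup>2 + q"
    by (cases q) (simp_all add: power2_eq_square)
  moreover have f: "f (x, y) \<in> nonscalar (a + b) (a * b)" if "y \<noteq> 0" for x y
  proof -
    have e: "y * (- (x - a) * (x - b) / y) = - (x - a) * (x - b)"
      using that by simp
    show ?thesis
      by (simp only: nonscalar_split[OF assms(1)] f_def prod.case tr.simps dt.simps e mem_Collect_eq)
        (simp add: algebra_simps)
  qed
  have "g (x, z) \<in> nonscalar (a + b) (a * b)" if "x \<in> {a, b}" for x z
    using that by (auto simp: nonscalar_split[OF assms(1)] g_def)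
  then have "P \<union> R \<subseteq> nonscalar (a + b) (a * b)"
    using f by (auto simp: P_def R_def)
  then have "card (P \<union> R) \<le> card (nonscalar (a + b) (a * b))"
    by (rule card_mono[rotated]) simp
  ultimately show ?thesis
    by simp
qed

text \<open>\<open>U\<close> is determined by its part outside \<open>W\<close>, which is arbitrary,
  and its part in \<open>W\<close>, a nonempty subset of \<open>W \<inter> F\<close>; nonemptiness
  accounts for the \<open>- 1\<close>.\<close>

lemma card_trace_in_subset:
  assumes X: "finite X" "W \<subseteq> X" and N: "N \<le> card W" and F: "card (W \<inter> F) \<le> n"
  shows "card {U. U \<subseteq> X \<and> U \<inter> W \<noteq> {} \<and> U \<inter> W \<subseteq> F} \<le> 2 ^ (card X - N) * (2 ^ n - 1)"
proof -
  have W: "finite W"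
    using X finite_subset by blast
  have "card {U. U \<subseteq> X \<and> U \<inter> W \<noteq> {} \<and> U \<inter> W \<subseteq> F} \<le> card (Pow (X - W) \<times> (Pow (W \<inter> F) - {{}}))"
  proof (rule card_inj_on_le)
    show "inj_on (\<lambda>U. (U - W, U \<inter> W)) {U. U \<subseteq> X \<and> U \<inter> W \<noteq> {} \<and> U \<inter> W \<subseteq> F}"
      by (rule inj_onI) blast
  qed (use X W in auto)
  also have "\<dots> = 2 ^ (card X - card W) * (2 ^ card (W \<inter> F) - 1)"
    using X W card_Pow[of "W \<inter> F"]
    by (simp add: card_cartesian_product card_Pow card_Diff_subset card_Diff_singleton)
  also have "\<dots> \<le> 2 ^ (card X - N) * (2 ^ n - 1)"
    using N F by (intro mult_le_mono diff_le_mono power_increasing) auto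
  finally show ?thesis .
qed

lemma card_field_ge_2: "2 \<le> card (UNIV :: 'a::{field,finite} set)"
proof -
  have "card {0, 1 :: 'a} \<le> card (UNIV :: 'a set)"
    by (rule card_mono) auto
  then show ?thesis
    by simp
qed

lemma card_bad_split:
  defines "q \<equiv> card (UNIV :: 'a::{field,finite} set)"
  defines "X \<equiv> split_mats :: 'a m2 set"
  shows "card {U. U \<subseteq> X \<and> \<not> purely_core_m2 U} \<le> q * (q - 1) * (q + 1) * (2 ^ (card X - (q\<^sup>2 + q)) * (2 ^ q - 1))"
proof -
  \<comment> \<open>Ordered pairs of distinct roots, the first being the eigenvalue, together with a
    line of row vectors: the index set of a union bound.\<close>
  define I where "I = Sigma (UNIV :: 'a set) (\<lambda>a. UNIV - {a}) \<times> (UNIV :: 'a option set)"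
  define bad where "bad = (\<lambda>((a, b), n). {U. U \<subseteq> X \<and> U \<inter> nonscalar (a + b) (a * b) \<noteq> {} \<and>
    U \<inter> nonscalar (a + b) (a * b) \<subseteq> {A. eigrow n a A}})"
  have "card (UNIV :: 'a option set) = q + 1"
    by (simp add: UNIV_option_conv card_image q_def)
  then have I: "card I = q * (q - 1) * (q + 1)"
    by (simp add: I_def card_cartesian_product card_SigmaI card_Diff_singleton q_def)
  have "{U. U \<subseteq> X \<and> \<not> purely_core_m2 U} \<subseteq> (\<Union>i\<in>I. bad i)"
  proof
    fix U assume "U \<in> {U. U \<subseteq> X \<and> \<not> purely_core_m2 U}"
    then obtain s d where U: "U \<subseteq> X" and nc: "\<not> core_m2 (U \<inter> nonscalar s d)"
      by (auto simp: purely_core_m2_def)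
    then have "U \<inter> nonscalar s d \<noteq> {}"
      using core_m2_empty by metis
    then obtain A where "A \<in> U" "A \<in> nonscalar s d"
      by blast
    then obtain a b where ab: "a \<noteq> b" "s = a + b" "d = a * b"
      using U by (auto simp: X_def split_mats_def nonscalar_def)
    from noncore_split[OF Int_lower2 nc[unfolded ab]] obtain \<beta> l
      where ne: "U \<inter> nonscalar (a + b) (a * b) \<noteq> {}" and \<beta>0: "\<beta> \<noteq> 0" and l: "l \<in> {a, b}"
        and \<beta>: "\<forall>A\<in>U \<inter> nonscalar (a + b) (a * b). \<beta> * A = \<beta> * sc l"
      by (elim exE conjE)
    obtain n where n: "\<And>A. \<beta> * A = \<beta> * sc l \<Longrightarrow> eigrow n l A"
      using eigrow_exists[OF \<beta>0] by blast
    have sub: "U \<inter> nonscalar (a + b) (a * b) \<subseteq> {A. eigrow n l A}"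
      using \<beta> n by auto
    \<comment> \<open>The root other than \<open>l\<close>, so that the eigenvalue comes first in
      the pair.\<close>
    define b' where "b' = (if l = a then b else a)"
    have "l \<noteq> b'" "a + b = l + b'" "a * b = l * b'"
      using l ab by (auto simp: b'_def)
    then have "((l, b'), n) \<in> I" "U \<in> bad ((l, b'), n)"
      using U ne sub by (auto simp: I_def bad_def)
    then show "U \<in> (\<Union>i\<in>I. bad i)"
      by blast
  qed
  then have "card {U. U \<subseteq> X \<and> \<not> purely_core_m2 U} \<le> card (\<Union>i\<in>I. bad i)"
    by (rule card_mono[rotated]) simp
  also have "\<dots> \<le> (\<Sum>i\<in>I. card (bad i))"
    by (rule card_UN_le) simp
  also have "\<dots> \<le> (\<Sum>i\<in>I. 2 ^ (card X - (q\<^sup>2 + q)) * (2 ^ q - 1))"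
  proof (rule sum_mono)
    fix i assume "i \<in> I"
    then obtain a b n where i: "i = ((a, b), n)" "a \<noteq> b"
      by (auto simp: I_def)
    show "card (bad i) \<le> 2 ^ (card X - (q\<^sup>2 + q)) * (2 ^ q - 1)"
      unfolding i bad_def prod.case
    proof (rule card_trace_in_subset)
      show "nonscalar (a + b) (a * b) \<subseteq> X"
        unfolding X_def using i(2) by (intro nonscalar_subset_split_mats) auto
      show "q\<^sup>2 + q \<le> card (nonscalar (a + b) (a * b))"
        unfolding q_def by (rule card_nonscalar_split[OF i(2)])
      show "card (nonscalar (a + b) (a * b) \<inter> {A. eigrow n a A}) \<le> q"
        unfolding q_def by (rule card_eigrow)
    qed simp
  qed
  finally show ?thesis
    by (simp add: I)
qed

text \<open>Passing from q to q + 1 multiplies the cube by at most 4 once q is at least 3. At q = 2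
  both sides equal 8, so \<open>numeric_bound\<close> treats that value separately.\<close>

lemma cube_less_power:
  fixes q :: nat
  assumes "q \<ge> 3"
  shows "q ^ 3 < 2 ^ (2 * q - 1)"
  using assms
proof (induction q rule: nat_induct_at_least)
  case (Suc q)
  obtain r where r: "q = r + 3"
    using Suc(1) by (metis add.commute le_Suc_ex)
  have "Suc q ^ 3 \<le> 4 * q ^ 3"
    by (simp add: r power3_eq_cube algebra_simps)
  also have "\<dots> < 4 * 2 ^ (2 * q - 1)"
    using Suc by simp
  also have "\<dots> = 2 ^ (2 * Suc q - 1)"
    using Suc(1) by (cases q) simp_all
  finally show ?case .
qed simp

text \<open>For q at least 3 one has k at least q, so the cubic factor is below 2^(k + q - 1). The
  other factors are at most 2^q and 2^(k + 1), and the exponents add up to 2k + 2q = q^2 + q. For q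
  = 2 the claim is 54 < 64.\<close>

lemma numeric_bound:
  fixes q :: nat
  assumes q: "q \<ge> 2" and k: "k = (q\<^sup>2 - q) div 2"
  shows "q * (q - 1) * (q + 1) * (2 ^ q - 1) * (2 ^ k + 1) < (2 :: nat) ^ (q\<^sup>2 + q)"
proof (cases "q = 2")
  case True
  then show ?thesis
    by (simp add: k)
next
  case False
  then have q3: "q \<ge> 3"
    using q by simp
  have "even (q\<^sup>2 - q)"
    by (simp add: power2_eq_square)
  moreover have "q \<le> q\<^sup>2"
    using q by (simp add: power2_eq_square)
  ultimately have k2: "q\<^sup>2 = 2 * k + q"
    unfolding k by simp
  have "3 * q \<le> q\<^sup>2"
    using q3 by (simp add: power2_eq_square)
  then have kq: "q \<le> k"
    using k2 by simp
  have "q * (q - 1) * (q + 1) \<le> q ^ 3"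
    by (cases q) (simp_all add: power3_eq_cube algebra_simps)
  also have "\<dots> < 2 ^ (2 * q - 1)"
    using q3 by (rule cube_less_power)
  also have "\<dots> \<le> 2 ^ (k + q - 1)"
    using kq by (intro power_increasing) auto
  finally have 1: "q * (q - 1) * (q + 1) < 2 ^ (k + q - 1)" .
  have "q * (q - 1) * (q + 1) * (2 ^ q - 1) * (2 ^ k + 1) \<le> q * (q - 1) * (q + 1) * 2 ^ q * 2 ^ (k + 1)"
    by (intro mult_le_mono) auto
  also have "\<dots> < 2 ^ (k + q - 1) * 2 ^ q * 2 ^ (k + 1)"
    using 1 by simp
  also have "\<dots> = 2 ^ (k + q - 1 + q + (k + 1))"
    by (simp add: power_add)
  also have "k + q - 1 + q + (k + 1) = q\<^sup>2 + q"
    using k2 q by simp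
  finally show ?thesis .
qed

lemma card_subsets_toM:
  "card {S. S \<subseteq> carrier M2 \<and> P S} = card {T :: 'a::field m2 set. P (toM ` T)}"
proof -
  have "{S. S \<subseteq> carrier M2 \<and> P S} = (`) toM ` {T :: 'a m2 set. P (toM ` T)}"
  proof (intro subset_antisym subsetI)
    fix S :: "'a mat set" assume S: "S \<in> {S. S \<subseteq> carrier M2 \<and> P S}"
    then have "S \<subseteq> range toM"
      by (simp add: ring_mat_simps range_toM)
    then obtain T where "S = toM ` T"
      by (metis subset_imageE)
    then show "S \<in> (`) toM ` {T :: 'a m2 set. P (toM ` T)}"
      using S by blast
  qed (auto simp: ring_mat_simps)
  moreover have "inj_on ((`) toM) {T :: 'a m2 set. P (toM ` T)}"
    by (intro inj_onI) (simp add: inj_image_eq_iff inj_def)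
  ultimately show ?thesis
    by (simp add: card_image)
qed

theorem theorem4:
  fixes q k c c' :: nat
  assumes "q = card (UNIV :: 'a::{field,finite} set)"
    and "k = (q\<^sup>2 - q) div 2"
    and "c = card {S :: 'a mat set. S \<subseteq> carrier M2 \<and> purely_core S}"
    and "c' = card {S :: 'a mat set. S \<subseteq> carrier M2 \<and> core S \<and> \<not> purely_core S}"
  shows "real c' < (1 / 2 ^ k) * real c"
proof -
  define X where "X = (split_mats :: 'a m2 set)"
  define B where "B = {U. U \<subseteq> X \<and> \<not> purely_core_m2 U}"
  define G where "G = {U. U \<subseteq> X \<and> purely_core_m2 U}"
  define Y where "Y = {V. V \<subseteq> - X \<and> purely_core_m2 V}"
  have purely_core_m2: "purely_core_m2 S \<longleftrightarrow> purely_core (toM ` S)" for S :: "'a m2 set"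
    by (simp add: purely_core_m2_def purely_core_toM)
  have c: "c = card {S :: 'a m2 set. purely_core_m2 S}"
    unfolding assms(3) card_subsets_toM by (simp add: purely_core_m2)
  have c': "c' = card {S :: 'a m2 set. core_m2 S \<and> \<not> purely_core_m2 S}"
    unfolding assms(4) card_subsets_toM by (simp add: purely_core_m2 core_toM)
  have q: "q \<ge> 2"
    unfolding assms(1) by (rule card_field_ge_2)
  have inj: "inj_on (\<lambda>S. (S \<inter> X, S - X)) M" for M
    by (rule inj_onI) blast
  have "card (G \<times> Y) \<le> card {S :: 'a m2 set. purely_core_m2 S}"
  proof (rule card_inj_on_le)
    show "inj_on (\<lambda>(U, V). U \<union> V) (G \<times> Y)"
      by (rule inj_onI) (auto simp: G_def Y_def)
    have "purely_core_m2 (U \<union> V)" if "U \<in> G" "V \<in> Y" for U V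
    proof -
      have "(U \<union> V) \<inter> X = U" "(U \<union> V) - X = V"
        using that by (auto simp: G_def Y_def)
      then show ?thesis
        using that by (subst purely_core_m2_iff) (simp add: G_def Y_def flip: X_def)
    qed
    then show "(\<lambda>(U, V). U \<union> V) ` (G \<times> Y) \<subseteq> {S. purely_core_m2 S}"
      by auto
  qed simp
  then have cG: "card G * card Y \<le> c"
    by (simp add: c card_cartesian_product)
  have "card {S :: 'a m2 set. core_m2 S \<and> \<not> purely_core_m2 S} \<le> card (B \<times> Y)"
  proof (rule card_inj_on_le[OF inj])
    have "S \<inter> X \<in> B" "S - X \<in> Y" if "core_m2 S" "\<not> purely_core_m2 S" for S
      using that core_imp_purely_core_m2_nonsplit[of S] purely_core_m2_iff[of S] by (auto simp: X_def B_def Y_def)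
    then show "(\<lambda>S. (S \<inter> X, S - X)) ` {S. core_m2 S \<and> \<not> purely_core_m2 S} \<subseteq> B \<times> Y"
      by blast
  qed simp
  then have cB: "c' \<le> card B * card Y"
    by (simp add: c' card_cartesian_product)
  \<comment> \<open>A nonempty \<open>Y\<close> keeps the inequality strict after multiplication by
    its size.\<close>
  have "{} \<in> Y"
    by (simp add: Y_def purely_core_m2_def core_m2_empty)
  then have Y: "card Y > 0"
    by (auto simp: card_gt_0_iff)
  have "G \<union> B = Pow X" "G \<inter> B = {}"
    by (auto simp: G_def B_def)
  then have GB: "card G + card B = 2 ^ card X"
    by (metis card_Pow card_Un_disjoint finite)
  \<comment> \<open>The class of x(x - 1) lies in \<open>X\<close>, so the truncated subtraction in
    the exponent is exact.\<close>
  have "card (nonscalar (0 + 1) (0 * 1) :: 'a m2 set) \<le> card X"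
    unfolding X_def by (intro card_mono nonscalar_subset_split_mats[of 0 1]) auto
  then have "q\<^sup>2 + q \<le> card X"
    using card_nonscalar_split[of "0 :: 'a" 1] by (simp add: assms(1))
  then have pow: "(2 :: nat) ^ card X = 2 ^ (q\<^sup>2 + q) * 2 ^ (card X - (q\<^sup>2 + q))"
    by (simp flip: power_add)
  have "card B \<le> q * (q - 1) * (q + 1) * (2 ^ (card X - (q\<^sup>2 + q)) * (2 ^ q - 1))"
    using card_bad_split[where 'a = 'a] unfolding B_def X_def assms(1) .
  \<comment> \<open>Since \<open>card G + card B = 2 ^ card X\<close>, the goal
    \<open>card B * 2 ^ k < card G\<close> amounts to
    \<open>card B * (2 ^ k + 1) < 2 ^ card X\<close>.\<close>
  then have "card B * (2 ^ k + 1) \<le>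
      q * (q - 1) * (q + 1) * (2 ^ (card X - (q\<^sup>2 + q)) * (2 ^ q - 1)) * (2 ^ k + 1)"
    by (rule mult_le_mono1)
  also have "\<dots> = q * (q - 1) * (q + 1) * (2 ^ q - 1) * (2 ^ k + 1) * 2 ^ (card X - (q\<^sup>2 + q))"
    by (simp only: ac_simps)
  also have "\<dots> < 2 ^ (q\<^sup>2 + q) * 2 ^ (card X - (q\<^sup>2 + q))"
    using numeric_bound[OF q assms(2)] by simp
  finally have "card B * 2 ^ k < card G"
    using GB pow by (simp add: algebra_simps)
  then have "card B * 2 ^ k * card Y < card G * card Y"
    using Y by simp
  moreover have "c' * 2 ^ k \<le> card B * 2 ^ k * card Y"
    using mult_le_mono1[OF cB, of "2 ^ k"] by (simp only: ac_simps)
  ultimately have "c' * 2 ^ k < c"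
    using cG by linarith
  then have "real (c' * 2 ^ k) < real c"
    by (simp only: of_nat_less_iff)
  then show ?thesis
    by (simp add: field_simps)
qed

end
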